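(* Let $x_0,x_1\in\mathbb{R}^n$ and let $(x_n,y_n,z_n)$ be generated from $x_0,x_1$ by the inertial-gradient method described in the context. Then for every $n\ge 1$, $$\Phi_{\lambda,\mu}(x_{n+1})\le \Phi_{\lambda,\mu}(x_n)+\Big(\frac{\eta\theta_n}{2}-\frac{\eta}{\gamma}+\frac{\eta}{2}\Big)\|x_{n+1}-x_n\|^2+\Big(\eta_1\theta_n^2+\eta\theta_n^2+\frac{\eta\theta_n}{2}\Big)\|x_n-x_{n-1}\|^2 .$$
   Context: $\|\cdot\|$ is the Euclidean norm on $\mathbb{R}^n$; for a symmetric positive definite matrix $D$, $\|x\|_D=\sqrt{x^TDx}$. For $m\ge 1$, $M_m$ is the set of symmetric positive definite $n\times n$ matrices with all eigenvalues in $[\frac1m,m]$. Standing assumptions: $g,f:\mathbb{R}^n\to\mathbb{R}\cup\{+\infty\}$ are proper convex lower semicontinuous with $\mathrm{dom}\,g\subset\mathrm{dom}\,f$; $\Phi=g-f$ (with $\Phi=+\infty$ outside $\mathrm{dom}\,g$) is bounded below and $\Phi(x)\ge\phi(\|x\|)+\beta$ for all $x$, where $\beta\in\mathbb{R}$ and $\phi:[0,+\infty)\to[0,+\infty)$ is nondecreasing and continuous with $\phi(0)=0$ and $\lim_{t\to\infty}\phi(t)=+\infty$; $D_1,D_2\in M_m$. Moreau envelopes: $g_{\lambda,D_1}(x)=\inf_{w}\{g(w)+\frac1{2\lambda}\|w-x\|_{D_1}^2\}$, $f_{\mu,D_2}(x)=\inf_{w}\{f(w)+\frac1{2\mu}\|w-x\|_{D_2}^2\}$,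 and $\Phi_{\lambda,\mu}=g_{\lambda,D_1}-f_{\mu,D_2}$. Proximal operators: $\mathrm{prox}_{\lambda g}^{D_1}(x)=\arg\min_w\{g(w)+\frac1{2\lambda}\|w-x\|_{D_1}^2\}$, $\mathrm{prox}_{\mu f}^{D_2}(x)=\arg\min_w\{f(w)+\frac1{2\mu}\|w-x\|_{D_2}^2\}$. Constants: $\eta=(\frac1\lambda+\frac1\mu)(m+m^3)$ and $\eta_1=\max\Big\{\Big|\frac{-m^4\mu+\mu-\lambda m^2}{\lambda\mu m}\Big|,\Big|\frac{\lambda m^4+\mu m^2-\lambda}{\lambda\mu m}\Big|\Big\}$. Inertial-gradient method: choose $\lambda,\mu>0$ with $\lambda\ge m^2\mu$, $\gamma$ with $\frac{2\eta}{5\eta+2\eta_1}\le\gamma<1$, inertial parameters $\theta_n\ge0$, and $x_0,x_1\in\mathbb{R}^n$. For $n\ge1$ compute $$w_n=x_n+\theta_n(x_n-x_{n-1}),\quad y_n=\frac{D_1(w_n-\mathrm{prox}_{\lambda g}^{D_1}(w_n))}{\lambda},\quad z_n=\frac{D_2(w_n-\mathrm{prox}_{\mu f}^{D_2}(w_n))}{\mu},\quad x_{n+1}=x_n-\frac{\gamma}{\eta}(y_n-z_n).$$ (In practice the method is stopped if $y_n=z_n$; the iterates are regarded here as the infinite sequence defined by this recursion.) *)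

theory Defs
  imports "HOL-Analysis.Analysis"
begin

definition symmetric_pos_def :: "real ^ 'n ^ 'n \<Rightarrow> bool" where
  "symmetric_pos_def D \<longleftrightarrow> transpose D = D \<and> (\<forall>x. x \<noteq> 0 \<longrightarrow> x \<bullet> (D *v x) > 0)"

definition is_eigenvalue :: "real ^ 'n ^ 'n \<Rightarrow> real \<Rightarrow> bool" where
  "is_eigenvalue D c \<longleftrightarrow> (\<exists>v. v \<noteq> 0 \<and> D *v v = c *\<^sub>R v)"

definition spd_class :: "real \<Rightarrow> (real ^ 'n ^ 'n) set" where
  "spd_class m = {D. symmetric_pos_def D \<and> (\<forall>c. is_eigenvalue D c \<longrightarrow> 1 / m \<le> c \<and> c \<le> m)}"

definition norm_wrt :: "real ^ 'n ^ 'n \<Rightarrow> real ^ 'n \<Rightarrow> real" where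
  "norm_wrt D x = sqrt (x \<bullet> (D *v x))"

definition edom :: "('a \<Rightarrow> ereal) \<Rightarrow> 'a set" where
  "edom f = {x. f x < \<infinity>}"

text \<open>Functions into \<open>\<real> \<union> {+\<infinity>}\<close> are \<open>ereal\<close>-valued; the value \<open>-\<infinity>\<close> is excluded by properness.\<close>

definition proper_fun :: "('a \<Rightarrow> ereal) \<Rightarrow> bool" where
  "proper_fun f \<longleftrightarrow> (\<forall>x. f x \<noteq> -\<infinity>) \<and> edom f \<noteq> {}"

text \<open>The library's \<open>convex_on\<close> is for real-valued functions only. At \<open>u = 0\<close> or \<open>v = 0\<close> the
  \<open>ereal\<close> convention \<open>0 * \<infinity> = 0\<close> makes the inequality trivial.\<close>

definition convex_fun :: "('a::real_vector \<Rightarrow> ereal) \<Rightarrow> bool" where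
  "convex_fun f \<longleftrightarrow> (\<forall>x y. \<forall>u\<ge>0. \<forall>v\<ge>0. u + v = 1 \<longrightarrow>
     f (u *\<^sub>R x + v *\<^sub>R y) \<le> ereal u * f x + ereal v * f y)"

definition lsc_fun :: "('a::topological_space \<Rightarrow> ereal) \<Rightarrow> bool" where
  "lsc_fun f \<longleftrightarrow> (\<forall>x. f x \<le> Liminf (at x) f)"

text \<open>\<open>g - f\<close> on the domain of \<open>g\<close>, and \<open>+\<infinity>\<close> elsewhere.\<close>

definition dc_fun :: "('a \<Rightarrow> ereal) \<Rightarrow> ('a \<Rightarrow> ereal) \<Rightarrow> 'a \<Rightarrow> ereal" where
  "dc_fun g f x = (if x \<in> edom g then g x - f x else \<infinity>)"

definition prox_objective ::
  "(real ^ 'n \<Rightarrow> ereal) \<Rightarrow> real \<Rightarrow> real ^ 'n ^ 'n \<Rightarrow> real ^ 'n \<Rightarrow> real ^ 'n \<Rightarrow> ereal" where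
  "prox_objective h l D x w = h w + ereal (1 / (2 * l) * (norm_wrt D (w - x))\<^sup>2)"

definition moreau_env ::
  "(real ^ 'n \<Rightarrow> ereal) \<Rightarrow> real \<Rightarrow> real ^ 'n ^ 'n \<Rightarrow> real ^ 'n \<Rightarrow> ereal" where
  "moreau_env h l D x = (INF w. prox_objective h l D x w)"

text \<open>For proper convex lower semicontinuous \<open>h\<close>, positive \<open>l\<close> and positive definite \<open>D\<close> the
  minimizer exists and is unique, so the choice made by \<open>arg_min\<close> is immaterial.\<close>

definition prox ::
  "(real ^ 'n \<Rightarrow> ereal) \<Rightarrow> real \<Rightarrow> real ^ 'n ^ 'n \<Rightarrow> real ^ 'n \<Rightarrow> real ^ 'n" where
  "prox h l D x = arg_min_on (prox_objective h l D x) UNIV"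

text \<open>Under the hypotheses just mentioned both envelopes are finite everywhere, so this difference
  is never of the form \<open>\<infinity> - \<infinity>\<close>.\<close>

definition dc_env ::
  "(real ^ 'n \<Rightarrow> ereal) \<Rightarrow> (real ^ 'n \<Rightarrow> ereal) \<Rightarrow> real \<Rightarrow> real \<Rightarrow>
   real ^ 'n ^ 'n \<Rightarrow> real ^ 'n ^ 'n \<Rightarrow> real ^ 'n \<Rightarrow> ereal" where
  "dc_env g f lam mu D1 D2 x = moreau_env g lam D1 x - moreau_env f mu D2 x"

definition eta_const :: "real \<Rightarrow> real \<Rightarrow> real \<Rightarrow> real" where
  "eta_const m lam mu = (1 / lam + 1 / mu) * (m + m ^ 3)"

definition eta1_const :: "real \<Rightarrow> real \<Rightarrow> real \<Rightarrow> real" where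
  "eta1_const m lam mu =
     max \<bar>(- (m ^ 4 * mu) + mu - lam * m\<^sup>2) / (lam * mu * m)\<bar>
         \<bar>(lam * m ^ 4 + mu * m\<^sup>2 - lam) / (lam * mu * m)\<bar>"

end

theory Submission
  imports Defs
begin

text \<open>
  Both envelopes are differentiable convex functions whose gradients at \<open>w\<^sub>n\<close> are \<open>y\<^sub>n\<close> and \<open>z\<^sub>n\<close>,
  and each satisfies the convexity lower bound and the quadratic upper bound with constant
  \<open>m / lam\<close>, respectively \<open>m / mu\<close>. Applying the upper bound to one envelope and the lower bound to
  the other, from \<open>w\<^sub>n\<close> to \<open>x\<^sub>n\<^sub>+\<^sub>1\<close> and from \<open>w\<^sub>n\<close> to \<open>x\<^sub>n\<close>, gives
  \<open>\<Phi>(x\<^sub>n\<^sub>+\<^sub>1) - \<Phi>(x\<^sub>n) \<le> \<langle>y\<^sub>n - z\<^sub>n, x\<^sub>n\<^sub>+\<^sub>1 - x\<^sub>n\<rangle> + m / (2 lam) \<parallel>x\<^sub>n\<^sub>+\<^sub>1 - w\<^sub>n\<parallel>\<^sup>2 + m / (2 mu) \<parallel>x\<^sub>n - w\<^sub>n\<parallel>\<^sup>2\<close>.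
  The inner product equals \<open>- (\<eta> / \<gamma>) \<parallel>x\<^sub>n\<^sub>+\<^sub>1 - x\<^sub>n\<parallel>\<^sup>2\<close>, and the constants \<open>m / lam\<close> and \<open>m / mu\<close> are
  dominated by \<open>\<eta>\<close>.
\<close>

section \<open>Quadratic forms\<close>

lemma symmetric_inner_commute:
  fixes D :: "real ^ 'n ^ 'n"
  assumes "transpose D = D"
  shows "x \<bullet> (D *v y) = y \<bullet> (D *v x)"
  by (metis assms dot_lmul_matrix inner_commute transpose_matrix_vector)

lemma quadratic_form_add:
  fixes D :: "real ^ 'n ^ 'n"
  assumes "transpose D = D"
  shows "(a + b) \<bullet> (D *v (a + b)) = a \<bullet> (D *v a) + 2 * (b \<bullet> (D *v a)) + b \<bullet> (D *v b)"
  using symmetric_inner_commute[OF assms, of a b]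
  by (simp add: matrix_vector_right_distrib inner_add_left inner_add_right)

lemma quadratic_form_diff:
  fixes D :: "real ^ 'n ^ 'n"
  assumes "transpose D = D"
  shows "(a - b) \<bullet> (D *v (a - b)) = a \<bullet> (D *v a) - 2 * (b \<bullet> (D *v a)) + b \<bullet> (D *v b)"
  using symmetric_inner_commute[OF assms, of a b]
  by (simp add: matrix_vector_mult_diff_distrib inner_diff_left inner_diff_right)

lemma quadratic_form_scaleR:
  fixes D :: "real ^ 'n ^ 'n"
  shows "(t *\<^sub>R a) \<bullet> (D *v (t *\<^sub>R a)) = t\<^sup>2 * (a \<bullet> (D *v a))"
  by (simp add: matrix_vector_mult_scaleR power2_eq_square)

lemma matrix_vector_mult_diff_swap:
  fixes D :: "real ^ 'n ^ 'm"
  shows "D *v (x - y) = - (D *v (y - x))"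
  by (simp add: matrix_vector_mult_diff_distrib)

lemma continuous_on_quadratic_form:
  fixes D :: "real ^ 'n ^ 'n"
  assumes "continuous_on S h"
  shows "continuous_on S (\<lambda>x. h x \<bullet> (D *v h x))"
  by (intro continuous_intros assms continuous_on_compose2[OF matrix_vector_mult_linear_continuous_on[of UNIV D]]) auto

lemma quadratic_form_normalize:
  fixes D :: "real ^ 'n ^ 'n"
  assumes "x \<noteq> 0"
  shows "x \<bullet> (D *v x) = (norm x)\<^sup>2 * ((x /\<^sub>R norm x) \<bullet> (D *v (x /\<^sub>R norm x)))"
  unfolding quadratic_form_scaleR using assms by (simp add: power_inverse)

section \<open>First-order conditions read off from inequalities in a small parameter\<close>

lemma nonneg_of_affine_nonneg:
  fixes a b :: real
  assumes "\<And>t. 0 < t \<Longrightarrow> t < 1 \<Longrightarrow> 0 \<le> a + t * b"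
  shows "0 \<le> a"
proof -
  have "((\<lambda>t. a + t * b) \<longlongrightarrow> a + 0 * b) (at_right 0)"
    by (intro tendsto_intros)
  then have lim: "((\<lambda>t. a + t * b) \<longlongrightarrow> a) (at_right 0)" by simp
  have "eventually (\<lambda>t. 0 \<le> a + t * b) (at_right 0)"
    using assms by (auto simp: eventually_at_right_field intro!: exI[of _ 1])
  then show ?thesis by (intro tendsto_lowerbound[OF lim]) auto
qed

text \<open>Both signs of \<open>t\<close> are admissible: dividing by \<open>t\<close> and letting
  \<open>t\<close> tend to 0 from above bounds \<open>a\<close> below, and replacing
  \<open>t\<close> by \<open>-t\<close> bounds it above. This is the vanishing of a first variation
  at an extremum.\<close>

lemma nonneg_quadratic_imp_linear_coeff_zero:
  fixes a b :: real
  assumes "\<And>t. 0 \<le> t * a + t\<^sup>2 * b"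
  shows "a = 0"
proof (rule antisym)
  have *: "0 \<le> t * (a + t * b)" "0 \<le> t * (- a + t * b)" for t
    using assms[of t] assms[of "- t"] by (simp_all add: power2_eq_square algebra_simps)
  have "0 \<le> a + t * b" "0 \<le> - a + t * b" if "0 < t" for t
    using *[of t] that by (simp_all add: zero_le_mult_iff)
  then show "0 \<le> a" and "a \<le> 0"
    using nonneg_of_affine_nonneg[of a b] nonneg_of_affine_nonneg[of "- a" b] by auto
qed

text \<open>The maximum of the Rayleigh quotient is an eigenvalue.\<close>

lemma quadratic_form_le_of_eigenvalues_le:
  fixes D :: "real ^ 'n ^ 'n"
  assumes sym: "transpose D = D" and ev: "\<And>c. is_eigenvalue D c \<Longrightarrow> c \<le> m"
  shows "x \<bullet> (D *v x) \<le> m * (norm x)\<^sup>2"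
proof -
  obtain v :: "real ^ 'n" where v: "norm v = 1"
    and vmax: "\<And>u. norm u = 1 \<Longrightarrow> u \<bullet> (D *v u) \<le> v \<bullet> (D *v v)"
    using continuous_attains_sup[of "sphere 0 1 :: (real ^ 'n) set" "\<lambda>x. x \<bullet> (D *v x)"]
      continuous_on_quadratic_form[OF continuous_on_id, of "sphere 0 1" D]
    by (auto simp: dist_norm)
  define M where "M = v \<bullet> (D *v v)"
  have le: "u \<bullet> (D *v u) \<le> M * (norm u)\<^sup>2" for u
  proof (cases "u = 0")
    case False
    then have "(u /\<^sub>R norm u) \<bullet> (D *v (u /\<^sub>R norm u)) \<le> M"
      unfolding M_def by (intro vmax) simp
    then show ?thesis
      unfolding quadratic_form_normalize[OF False, of D]
      by (metis mult.commute mult_right_mono zero_le_power2)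
  qed simp
  \<comment> \<open>\<open>M * (norm u)\<^sup>2 - u \<bullet> (D *v u)\<close> is nonnegative
    everywhere and vanishes at \<open>v\<close>, so its linear term along every direction
    \<open>u\<close> is zero. With the residual itself as direction this forces
    \<open>D *v v = M *\<^sub>R v\<close>.\<close>
  have orth: "u \<bullet> (M *\<^sub>R v - D *v v) = 0" for u
  proof -
    have "0 \<le> t * (2 * (u \<bullet> (M *\<^sub>R v - D *v v))) + t\<^sup>2 * (M * (norm u)\<^sup>2 - u \<bullet> (D *v u))" for t
    proof -
      have "(v + t *\<^sub>R u) \<bullet> (D *v (v + t *\<^sub>R u)) \<le> M * (norm (v + t *\<^sub>R u))\<^sup>2"
        by (rule le)
      moreover have "(norm (v + t *\<^sub>R u))\<^sup>2 = 1 + 2 * t * (u \<bullet> v) + t\<^sup>2 * (norm u)\<^sup>2"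
        using v unfolding power2_norm_eq_inner norm_eq_1
        by (simp add: inner_add_left inner_add_right inner_commute power2_eq_square)
      ultimately show ?thesis
        unfolding quadratic_form_add[OF sym] quadratic_form_scaleR M_def[symmetric]
        by (simp add: inner_diff_right algebra_simps)
    qed
    from nonneg_quadratic_imp_linear_coeff_zero[OF this] show ?thesis by simp
  qed
  have "D *v v = M *\<^sub>R v"
    using orth[of "M *\<^sub>R v - D *v v"] by simp
  moreover have "v \<noteq> 0" using v by auto
  ultimately have "M \<le> m" using ev unfolding is_eigenvalue_def by blast
  then show ?thesis using le[of x] by (meson mult_right_mono order_trans zero_le_power2)
qed

text \<open>The form is positive on the compact unit sphere, so its minimum there is a positive
  constant, and homogeneity does the rest. The bound serves to make proximal objectives grow
  quadratically.\<close>

lemma symmetric_pos_def_coercive: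
  fixes D :: "real ^ 'n ^ 'n"
  assumes "symmetric_pos_def D"
  obtains k where "k > 0" "\<And>x. k * (norm x)\<^sup>2 \<le> x \<bullet> (D *v x)"
proof -
  obtain v :: "real ^ 'n" where v: "norm v = 1"
    and vmin: "\<And>u. norm u = 1 \<Longrightarrow> v \<bullet> (D *v v) \<le> u \<bullet> (D *v u)"
    using continuous_attains_inf[of "sphere 0 1 :: (real ^ 'n) set" "\<lambda>x. x \<bullet> (D *v x)"]
      continuous_on_quadratic_form[OF continuous_on_id, of "sphere 0 1" D]
    by (auto simp: dist_norm)
  have "v \<noteq> 0" using v by auto
  show ?thesis
  proof (rule that[of "v \<bullet> (D *v v)"])
    show "v \<bullet> (D *v v) > 0"
      using assms \<open>v \<noteq> 0\<close> unfolding symmetric_pos_def_def by blast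
    show "v \<bullet> (D *v v) * (norm x)\<^sup>2 \<le> x \<bullet> (D *v x)" for x
    proof (cases "x = 0")
      case False
      then have "v \<bullet> (D *v v) \<le> (x /\<^sub>R norm x) \<bullet> (D *v (x /\<^sub>R norm x))"
        by (intro vmin) simp
      then show ?thesis
        unfolding quadratic_form_normalize[OF False, of D]
        by (metis mult.commute mult_right_mono zero_le_power2)
    qed simp
  qed
qed

lemma symmetric_pos_def_nonneg:
  assumes "symmetric_pos_def D"
  shows "0 \<le> x \<bullet> (D *v x)"
  using assms unfolding symmetric_pos_def_def by (cases "x = 0") (auto intro: less_imp_le)

lemma norm_wrt_power2:
  assumes "symmetric_pos_def D"
  shows "(norm_wrt D x)\<^sup>2 = x \<bullet> (D *v x)"
  using symmetric_pos_def_nonneg[OF assms] by (simp add: norm_wrt_def)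

section \<open>Existence of proximal points\<close>

lemma lsc_fun_open_superlevel:
  assumes "lsc_fun f"
  shows "open {x. c < f x}"
proof (subst open_subopen, safe)
  fix x assume "c < f x"
  then have "c < Liminf (at x) f" using assms unfolding lsc_fun_def by (metis less_le_trans)
  then have "eventually (\<lambda>u. c < f u) (at x)" by (rule less_LiminfD)
  \<comment> \<open>The limit inferior in \<open>lsc_fun\<close> is over punctured neighbourhoods,
    so the point \<open>x\<close> itself has to be added by hand.\<close>
  then have "eventually (\<lambda>u. c < f u) (nhds x)"
    using \<open>c < f x\<close> by (auto simp: eventually_at_filter elim!: eventually_mono)
  then show "\<exists>T. open T \<and> x \<in> T \<and> T \<subseteq> {x. c < f x}"
    unfolding eventually_nhds by blast
qed

text \<open>Without a minimizer the open sets \<open>{x. f u < f x}\<close> with \<open>u\<close> in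
  \<open>K\<close> would cover \<open>K\<close>. In a finite subcover, the centre with the least
  value lies in none of the sets.\<close>

lemma compact_attains_inf_of_open_superlevel:
  fixes f :: "'a::topological_space \<Rightarrow> 'b::linorder"
  assumes "compact K" "K \<noteq> {}" "\<And>c. open {x. c < f x}"
  obtains p where "p \<in> K" "\<And>u. u \<in> K \<Longrightarrow> f p \<le> f u"
proof (rule ccontr)
  assume "\<not> thesis"
  then have "\<And>x. x \<in> K \<Longrightarrow> \<exists>u\<in>K. f u < f x"
    using that by (meson not_le)
  then have "K \<subseteq> (\<Union>u\<in>K. {x. f u < f x})" by blast
  then obtain F where F: "F \<subseteq> K" "finite F" "K \<subseteq> (\<Union>u\<in>F. {x. f u < f x})"
    using compactE_image[OF \<open>compact K\<close>, of K "\<lambda>u. {x. f u < f x}"] assms(3) by metis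
  then have "F \<noteq> {}" using \<open>K \<noteq> {}\<close> by auto
  then obtain p where "p \<in> F" "\<And>u. u \<in> F \<Longrightarrow> f p \<le> f u"
    using \<open>finite F\<close> by (metis arg_min_if_finite(1) arg_min_least)
  then show False using F by (force simp: not_le[symmetric])
qed

text \<open>A real \<open>r\<close> inserted strictly between \<open>c - q x\<close> and
  \<open>h x\<close> separates the two summands, which writes the superlevel set as a union of open
  intersections. A real separator also covers infinite values of \<open>h\<close> and
  \<open>c\<close>.\<close>

lemma lsc_fun_add_continuous_open_superlevel:
  fixes h :: "'a::topological_space \<Rightarrow> ereal"
  assumes "lsc_fun h" "continuous_on UNIV q"
  shows "open {x. c < h x + ereal (q x)}"
proof -
  have "{x. c < h x + ereal (q x)} = (\<Union>r. {x. ereal r < h x} \<inter> {x. c < ereal (r + q x)})"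
  proof (intro set_eqI iffI)
    fix x assume "x \<in> {x. c < h x + ereal (q x)}"
    then have "c - ereal (q x) < h x"
      by (cases c; cases "h x") auto
    then obtain r where "c - ereal (q x) < ereal r" "ereal r < h x"
      using ereal_dense2 by blast
    then show "x \<in> (\<Union>r. {x. ereal r < h x} \<inter> {x. c < ereal (r + q x)})"
      by (cases c) auto
  next
    fix x assume "x \<in> (\<Union>r. {x. ereal r < h x} \<inter> {x. c < ereal (r + q x)})"
    then obtain r where "ereal r < h x" "c < ereal (r + q x)" by auto
    then show "x \<in> {x. c < h x + ereal (q x)}"
      by (cases c; cases "h x") auto
  qed
  moreover have "open {x. c < ereal (r + q x)}" for r
    by (intro open_Collect_less continuous_intros assms)
  ultimately show ?thesis
    using lsc_fun_open_superlevel[OF assms(1)] by (simp add: open_Int open_UN)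
qed

text \<open>A minimum on the unit ball about \<open>x0\<close> propagates along rays by convexity; this replaces an
  affine minorant.\<close>

lemma convex_lsc_linear_lower_bound:
  fixes h :: "'a::euclidean_space \<Rightarrow> ereal"
  assumes proper: "proper_fun h" and conv: "convex_fun h" and lsc: "lsc_fun h"
    and x0: "h x0 = ereal a"
  obtains C where "C \<ge> 0" "\<And>w. ereal (- C * (1 + norm (w - x0))) \<le> h w"
proof -
  obtain p where p: "p \<in> cball x0 1" "\<And>u. u \<in> cball x0 1 \<Longrightarrow> h p \<le> h u"
    using compact_attains_inf_of_open_superlevel[of "cball x0 1" h] lsc_fun_open_superlevel[OF lsc]
    by (metis compact_cball centre_in_cball empty_iff zero_le_one)
  have "h p \<noteq> - \<infinity>" using proper unfolding proper_fun_def by blast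
  moreover have "h p \<le> ereal a" using p(2)[of x0] x0 by simp
  ultimately obtain c where c: "h p = ereal c" by (cases "h p") auto
  \<comment> \<open>\<open>\<bar>c\<bar>\<close> pays for the minimum on the unit ball,
    \<open>\<bar>a\<bar>\<close> for the value at \<open>x0\<close> that enters when a ray is
    extended beyond the ball.\<close>
  define C where "C = \<bar>a\<bar> + \<bar>c\<bar>"
  have "ereal (- C * (1 + norm (w - x0))) \<le> h w" for w
  proof (cases "norm (w - x0) \<le> 1")
    case True
    have "C * 1 \<le> C * (1 + norm (w - x0))" by (intro mult_left_mono) (auto simp: C_def)
    moreover have "- C \<le> c" by (simp add: C_def)
    ultimately have "- C * (1 + norm (w - x0)) \<le> c" by simp
    moreover have "ereal c \<le> h w"
      using True p(2)[of w] c by (simp add: dist_norm norm_minus_commute)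
    ultimately show ?thesis by (meson ereal_less_eq(3) order_trans)
  next
    case False
    define r where "r = norm (w - x0)"
    have r: "r > 1" using False r_def by simp
    \<comment> \<open>\<open>v\<close> is the point where the segment from \<open>x0\<close> to
      \<open>w\<close> meets the unit sphere about \<open>x0\<close>. There \<open>h\<close> is at
      least \<open>c\<close>, and convexity turns this into a lower bound for
      \<open>h w\<close>.\<close>
    define v where "v = (1 - 1 / r) *\<^sub>R x0 + (1 / r) *\<^sub>R w"
    have "v - x0 = (1 / r) *\<^sub>R (w - x0)" by (simp add: v_def algebra_simps)
    then have "norm (v - x0) = 1" using r by (simp add: r_def[symmetric])
    then have "ereal c \<le> h v" using p(2)[of v] c by (simp add: dist_norm norm_minus_commute)
    also have "h v \<le> ereal (1 - 1 / r) * h x0 + ereal (1 / r) * h w"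
      using conv r unfolding convex_fun_def v_def by simp
    finally have le: "ereal c \<le> ereal (1 - 1 / r) * ereal a + ereal (1 / r) * h w"
      unfolding x0 .
    show ?thesis
    proof (cases "h w")
      case (real b)
      then have "c \<le> (1 - 1 / r) * a + 1 / r * b" using le by simp
      then have "r * c \<le> r * ((1 - 1 / r) * a + 1 / r * b)" using r by (intro mult_left_mono) auto
      also have "\<dots> = (r - 1) * a + b" using r by (simp add: field_simps)
      finally have 1: "r * c \<le> (r - 1) * a + b" .
      have "(r - 1) * a \<le> (r - 1) * \<bar>a\<bar>" using r by (intro mult_left_mono) auto
      moreover have "- (r * \<bar>c\<bar>) \<le> r * c"
        using r mult_left_mono[of "- \<bar>c\<bar>" c r] by simp
      ultimately have "- C * (1 + r) \<le> b" using 1 unfolding C_def by (simp add: algebra_simps)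
      then show ?thesis using real r_def by simp
    next
      case MInf
      then show ?thesis using proper unfolding proper_fun_def by blast
    qed simp
  qed
  then show ?thesis using that[of C] by (simp add: C_def)
qed

section \<open>Existence and choice of a proximal point\<close>

lemma prox_objective_eq:
  assumes "symmetric_pos_def D"
  shows "prox_objective h l D x w = h w + ereal (1 / (2 * l) * ((w - x) \<bullet> (D *v (w - x))))"
  by (simp add: prox_objective_def norm_wrt_power2[OF assms])

lemma proper_fun_finite_point:
  assumes "proper_fun h"
  obtains x0 a where "h x0 = ereal a"
proof -
  obtain x0 where "h x0 < \<infinity>" "h x0 \<noteq> - \<infinity>" using assms unfolding proper_fun_def edom_def by blast
  then show ?thesis using that by (cases "h x0") auto
qed

text \<open>Quadratic growth of the penalty beats the linear lower bound on \<open>h\<close>.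
  Outside a large ball the objective is at least its value at \<open>x0\<close>, so a minimizer over
  the ball, which contains \<open>x0\<close>, is global.\<close>

lemma prox_objective_has_minimizer:
  fixes h :: "real ^ 'n \<Rightarrow> ereal"
  assumes proper: "proper_fun h" and conv: "convex_fun h" and lsc: "lsc_fun h"
    and l: "l > 0" and D: "symmetric_pos_def D"
  obtains p where "\<And>w. prox_objective h l D x p \<le> prox_objective h l D x w"
proof -
  obtain x0 a where x0: "h x0 = ereal a" using proper_fun_finite_point[OF proper] .
  obtain C where C: "C \<ge> 0" "\<And>w. ereal (- C * (1 + norm (w - x0))) \<le> h w"
    using convex_lsc_linear_lower_bound[OF proper conv lsc x0] by blast
  obtain k where k: "k > 0" "\<And>x. k * (norm x)\<^sup>2 \<le> x \<bullet> (D *v x)"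
    using symmetric_pos_def_coercive[OF D] by blast
  define q where "q w = 1 / (2 * l) * ((w - x) \<bullet> (D *v (w - x)))" for w
  define J where "J = prox_objective h l D x"
  have J: "J w = h w + ereal (q w)" for w
    unfolding J_def q_def prox_objective_eq[OF D] ..
  define A where "A = a + q x0"
  have JA: "J x0 = ereal A" by (simp add: J x0 A_def)
  define e where "e = norm (x0 - x)"
  define \<kappa> where "\<kappa> = k / (2 * l)"
  \<comment> \<open>\<open>B\<close> absorbs the target value \<open>A\<close> and the cost of
    recentring the linear bound from \<open>x0\<close> to \<open>x\<close>. In \<open>R\<close>, the
    entry \<open>e\<close> puts \<open>x0\<close> into the ball; the other entry gives
    \<open>d > 1\<close> and \<open>\<kappa> * d - C > B\<close> beyond it, hence
    \<open>\<kappa> * d\<^sup>2 - C * d \<ge> B\<close>.\<close>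
  define B where "B = \<bar>A\<bar> + C * (1 + e)"
  define R where "R = max e (1 + (C + B) / \<kappa>)"
  have \<kappa>: "\<kappa> > 0" using k l by (simp add: \<kappa>_def)
  have B: "B \<ge> 0" using C by (simp add: B_def e_def)
  have far: "ereal A \<le> J w" if "norm (w - x) > R" for w
  proof -
    define d where "d = norm (w - x)"
    have d: "d > 1 + (C + B) / \<kappa>" using that unfolding R_def d_def by simp
    then have d1: "d > 1" using C B \<kappa> by (smt (verit) divide_nonneg_pos)
    have "(C + B) / \<kappa> < d" using d by simp
    then have "C + B < d * \<kappa>" using \<kappa> by (simp add: pos_divide_less_eq)
    then have "B \<le> d * \<kappa> - C" by simp
    also have "\<dots> \<le> d * (d * \<kappa> - C)"
      using d1 \<open>C + B < d * \<kappa>\<close> B mult_right_mono[of 1 d "d * \<kappa> - C"] by simp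
    finally have 1: "B \<le> \<kappa> * d\<^sup>2 - C * d" by (simp add: algebra_simps power2_eq_square)
    have "norm (w - x0) \<le> d + e"
      unfolding d_def e_def using norm_triangle_ineq4[of "w - x" "x0 - x"] by simp
    then have "C * norm (w - x0) \<le> C * (d + e)" using C by (intro mult_left_mono)
    moreover have "\<kappa> * d\<^sup>2 \<le> q w"
      using k(2)[of "w - x"] l unfolding \<kappa>_def d_def q_def by (simp add: divide_right_mono)
    ultimately have "A \<le> - C * (1 + norm (w - x0)) + q w"
      using 1 unfolding B_def by (simp add: algebra_simps)
    then have "ereal A \<le> ereal (- C * (1 + norm (w - x0))) + ereal (q w)" by simp
    also have "\<dots> \<le> J w" unfolding J by (intro add_right_mono C(2))
    finally show ?thesis .
  qed
  have "continuous_on UNIV q"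
    unfolding q_def by (intro continuous_intros continuous_on_quadratic_form)
  then have "open {w. c < J w}" for c
    unfolding J by (intro lsc_fun_add_continuous_open_superlevel lsc)
  moreover have in_ball: "x0 \<in> cball x R"
    by (simp add: R_def e_def dist_norm norm_minus_commute)
  ultimately obtain p where p: "\<And>u. u \<in> cball x R \<Longrightarrow> J p \<le> J u"
    using compact_attains_inf_of_open_superlevel[of "cball x R" J] by (metis compact_cball empty_iff)
  have "J p \<le> J w" for w
  proof (cases "norm (w - x) > R")
    case True
    then show ?thesis using far p[OF in_ball] JA by (metis order_trans)
  next
    case False
    then show ?thesis by (intro p) (simp add: dist_norm norm_minus_commute)
  qed
  then show ?thesis using that unfolding J_def by blast
qed

lemma prox_minimizes:
  fixes h :: "real ^ 'n \<Rightarrow> ereal"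
  assumes "proper_fun h" "convex_fun h" "lsc_fun h" "l > 0" "symmetric_pos_def D"
  shows "prox_objective h l D x (prox h l D x) \<le> prox_objective h l D x w"
proof -
  obtain p where "\<And>w. prox_objective h l D x p \<le> prox_objective h l D x w"
    using prox_objective_has_minimizer[OF assms] by blast
  then have "is_arg_min (prox_objective h l D x) (\<lambda>u. u \<in> UNIV) p"
    by (simp add: is_arg_min_linorder)
  \<comment> \<open>\<open>arg_min\<close> is a Hilbert choice, so the existence of one minimizer
    \<open>p\<close> makes the chosen point a minimizer too.\<close>
  then have "is_arg_min (prox_objective h l D x) (\<lambda>u. u \<in> UNIV) (prox h l D x)"
    unfolding prox_def arg_min_on_def arg_min_def by (rule someI)
  then show ?thesis by (simp add: is_arg_min_linorder)
qed

section \<open>First-order bounds for Moreau envelopes\<close>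

lemma moreau_env_eq_prox_objective_prox:
  fixes h :: "real ^ 'n \<Rightarrow> ereal"
  assumes "proper_fun h" "convex_fun h" "lsc_fun h" "l > 0" "symmetric_pos_def D"
  shows "moreau_env h l D x = prox_objective h l D x (prox h l D x)"
  unfolding moreau_env_def
  by (intro antisym INF_lower INF_greatest prox_minimizes[OF assms]) auto

lemma finite_at_prox:
  fixes h :: "real ^ 'n \<Rightarrow> ereal"
  assumes "proper_fun h" "convex_fun h" "lsc_fun h" "l > 0" "symmetric_pos_def D"
  obtains a where "h (prox h l D x) = ereal a"
proof -
  obtain x0 b where "h x0 = ereal b" using proper_fun_finite_point[OF assms(1)] .
  then have "h (prox h l D x) \<noteq> \<infinity>"
    using prox_minimizes[OF assms, of x x0] unfolding prox_objective_def by auto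
  moreover have "h (prox h l D x) \<noteq> - \<infinity>" using assms(1) unfolding proper_fun_def by blast
  ultimately show ?thesis using that by (cases "h (prox h l D x)") auto
qed

text \<open>Optimality condition for the proximal point: \<open>p\<close> is compared with
  \<open>(1 - t) p + t w\<close>, convexity bounds \<open>h\<close> there, and after division by
  \<open>t\<close> the limit \<open>t -> 0\<close> removes the quadratic term.\<close>

lemma prox_subgradient:
  fixes h :: "real ^ 'n \<Rightarrow> ereal"
  assumes h: "proper_fun h" "convex_fun h" "lsc_fun h" "l > 0" "symmetric_pos_def D"
    and p: "p = prox h l D x"
  shows "h p + ereal (((1 / l) *\<^sub>R (D *v (x - p))) \<bullet> (w - p)) \<le> h w"
proof -
  obtain a where a: "h p = ereal a" using finite_at_prox[OF h] p by blast
  have sym: "transpose D = D" using h(5) unfolding symmetric_pos_def_def by blast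
  define s where "s = (w - p) \<bullet> (D *v (p - x))"
  define Q where "Q = (w - p) \<bullet> (D *v (w - p))"
  show ?thesis
  proof (cases "h w")
    case (real b)
    have "0 \<le> b - a + s / l + t * (Q / (2 * l))" if t: "0 < t" "t < 1" for t
    proof -
      define v where "v = (1 - t) *\<^sub>R p + t *\<^sub>R w"
      have "h v \<le> ereal (1 - t) * h p + ereal t * h w"
        using h(2) t unfolding convex_fun_def v_def by simp
      also have "\<dots> = ereal ((1 - t) * a + t * b)" by (simp add: a real)
      finally have 1: "h v \<le> ereal ((1 - t) * a + t * b)" .
      have vx: "v - x = (p - x) + t *\<^sub>R (w - p)" by (simp add: v_def algebra_simps)
      have eq: "(v - x) \<bullet> (D *v (v - x)) = (p - x) \<bullet> (D *v (p - x)) + 2 * t * s + t\<^sup>2 * Q"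
        unfolding vx quadratic_form_add[OF sym] quadratic_form_scaleR s_def Q_def by simp
      have "prox_objective h l D x p \<le> h v + ereal (1 / (2 * l) * ((v - x) \<bullet> (D *v (v - x))))"
        using prox_minimizes[OF h, of x v] unfolding p[symmetric] prox_objective_eq[OF h(5)] .
      also have "\<dots> \<le> ereal ((1 - t) * a + t * b) + ereal (1 / (2 * l) * ((v - x) \<bullet> (D *v (v - x))))"
        using 1 by (rule add_right_mono)
      finally have "a + 1 / (2 * l) * ((p - x) \<bullet> (D *v (p - x)))
          \<le> (1 - t) * a + t * b + 1 / (2 * l) * ((p - x) \<bullet> (D *v (p - x)) + 2 * t * s + t\<^sup>2 * Q)"
        unfolding prox_objective_eq[OF h(5)] a eq by simp
      then have "0 \<le> t * (b - a) + 1 / (2 * l) * (2 * t * s + t\<^sup>2 * Q)"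
        by (simp add: algebra_simps)
      also have "\<dots> = t * (b - a + s / l + t * (Q / (2 * l)))"
        using h(4) by (simp add: field_simps power2_eq_square)
      finally show ?thesis using t by (simp add: zero_le_mult_iff)
    qed
    then have "0 \<le> b - a + s / l" by (rule nonneg_of_affine_nonneg)
    moreover have "((1 / l) *\<^sub>R (D *v (x - p))) \<bullet> (w - p) = - s / l"
      unfolding matrix_vector_mult_diff_swap[of D x p] by (simp add: s_def inner_commute)
    ultimately show ?thesis by (simp add: a real)
  next
    case MInf
    then show ?thesis using h(1) unfolding proper_fun_def by blast
  qed simp
qed

text \<open>The vector \<open>(1 / l) D (x - prox x)\<close> acts as the gradient of the envelope.
  The lower bound combines the subgradient inequality at \<open>prox x\<close> with positivity of
  the form; the upper bound uses \<open>prox x\<close> as a competitor in the infimum at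
  \<open>u\<close>.\<close>

lemma moreau_env_first_order_bounds:
  fixes h :: "real ^ 'n \<Rightarrow> ereal"
  assumes h: "proper_fun h" "convex_fun h" "lsc_fun h" "l > 0" "symmetric_pos_def D"
  obtains E where "\<And>x. moreau_env h l D x = ereal (E x)"
    and "\<And>x u. E x + ((1 / l) *\<^sub>R (D *v (x - prox h l D x))) \<bullet> (u - x) \<le> E u"
    and "\<And>x u. E u \<le> E x + ((1 / l) *\<^sub>R (D *v (x - prox h l D x))) \<bullet> (u - x)
                + 1 / (2 * l) * ((u - x) \<bullet> (D *v (u - x)))"
proof -
  have sym: "transpose D = D" using h(5) unfolding symmetric_pos_def_def by blast
  define P where "P = prox h l D"
  have "\<exists>a. h (P x) = ereal a" for x using finite_at_prox[OF h, of x] unfolding P_def by blast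
  then obtain H where H: "\<And>x. h (P x) = ereal (H x)" by metis
  define E where "E x = H x + 1 / (2 * l) * ((P x - x) \<bullet> (D *v (P x - x)))" for x
  have E: "moreau_env h l D x = ereal (E x)" for x
    unfolding moreau_env_eq_prox_objective_prox[OF h] prox_objective_eq[OF h(5)]
      P_def[symmetric] H E_def by simp
  have cross: "((1 / l) *\<^sub>R (D *v (x - P x))) \<bullet> v = - (1 / l) * (v \<bullet> (D *v (P x - x)))" for x v
    unfolding matrix_vector_mult_diff_swap[of D x "P x"] by (simp add: inner_commute)
  show ?thesis
  proof (rule that[OF E], unfold P_def[symmetric])
    fix x u
    \<comment> \<open>In these displacements \<open>P u - P x = v + s - p\<close>, so the
      subgradient inequality involves only \<open>p\<close>, \<open>v\<close> and
      \<open>s\<close>.\<close>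
    define p where "p = P x - x"
    define v where "v = P u - u"
    define s where "s = u - x"
    have "h (P x) + ereal (((1 / l) *\<^sub>R (D *v (x - P x))) \<bullet> (P u - P x)) \<le> h (P u)"
      using prox_subgradient[OF h, of "P x" x "P u"] unfolding P_def by simp
    then have "H x + ((1 / l) *\<^sub>R (D *v (x - P x))) \<bullet> (P u - P x) \<le> H u" unfolding H by simp
    then have "H x - (1 / l) * ((v + s - p) \<bullet> (D *v p)) \<le> H u"
      unfolding cross p_def[symmetric] v_def s_def by (simp add: p_def)
    then have 1: "H x - (1 / l) * (v \<bullet> (D *v p) + s \<bullet> (D *v p) - p \<bullet> (D *v p)) \<le> H u"
      by (simp only: inner_add_left inner_diff_left)
    \<comment> \<open>Positivity at \<open>v - p\<close> is Young's inequality for the cross term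
      \<open>v \<bullet> (D *v p)\<close>. Its two halves match the penalties contained in
      \<open>E u\<close> and \<open>E x\<close>.\<close>
    have "0 \<le> 1 / (2 * l) * (v \<bullet> (D *v v) - 2 * (p \<bullet> (D *v v)) + p \<bullet> (D *v p))"
      using h(4) symmetric_pos_def_nonneg[OF h(5), of "v - p"]
      unfolding quadratic_form_diff[OF sym] by simp
    then have "0 \<le> 1 / (2 * l) * (v \<bullet> (D *v v) - 2 * (v \<bullet> (D *v p)) + p \<bullet> (D *v p))"
      unfolding symmetric_inner_commute[OF sym, of p v] .
    then have "(v \<bullet> (D *v p)) / l \<le> (v \<bullet> (D *v v)) / (2 * l) + (p \<bullet> (D *v p)) / (2 * l)"
      using h(4) by (simp add: field_simps)
    moreover have "(p \<bullet> (D *v p)) / l = (p \<bullet> (D *v p)) / (2 * l) + (p \<bullet> (D *v p)) / (2 * l)"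
      using h(4) by (simp add: field_simps)
    ultimately show "E x + ((1 / l) *\<^sub>R (D *v (x - P x))) \<bullet> (u - x) \<le> E u"
      unfolding cross E_def p_def[symmetric] v_def[symmetric] s_def[symmetric] using 1
      by (simp add: add_divide_distrib diff_divide_distrib)
  next
    fix x u
    have "ereal (E u) \<le> prox_objective h l D u (P x)"
      unfolding E[symmetric] moreau_env_def by (rule INF_lower) simp
    then have "E u \<le> H x + 1 / (2 * l) * ((P x - u) \<bullet> (D *v (P x - u)))"
      unfolding prox_objective_eq[OF h(5)] H by simp
    also have "P x - u = (P x - x) - (u - x)" by simp
    also note quadratic_form_diff[OF sym]
    finally show "E u \<le> E x + ((1 / l) *\<^sub>R (D *v (x - P x))) \<bullet> (u - x)
        + 1 / (2 * l) * ((u - x) \<bullet> (D *v (u - x)))"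
      unfolding cross E_def by (simp add: distrib_left right_diff_distrib)
  qed
qed

section \<open>The descent inequality\<close>

text \<open>The right side minus the left side is \<open>t * (norm (a + b))\<^sup>2\<close>. The
  weight \<open>t\<close> on both squares yields the terms \<open>\<eta> * \<theta> n / 2\<close> of
  the final estimate.\<close>

lemma norm_diff_scaleR_power2_le:
  fixes a b :: "'a::real_inner"
  assumes "t \<ge> 0"
  shows "(norm (a - t *\<^sub>R b))\<^sup>2 \<le> (1 + t) * (norm a)\<^sup>2 + (t\<^sup>2 + t) * (norm b)\<^sup>2"
proof -
  have "0 \<le> t * (norm (a + b))\<^sup>2" using assms by simp
  then show ?thesis unfolding power2_norm_eq_inner
    by (simp add: inner_add_left inner_add_right inner_diff_left inner_diff_right inner_commute
        algebra_simps power2_eq_square)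
qed

theorem theorem3p3:
  fixes g f :: "real ^ 'n \<Rightarrow> ereal"
    and D1 D2 :: "real ^ 'n ^ 'n"
    and m lam mu \<gamma> \<beta> \<eta> \<eta>1 :: real
    and \<phi> :: "real \<Rightarrow> real"
    and \<theta> :: "nat \<Rightarrow> real"
    and x w y z :: "nat \<Rightarrow> real ^ 'n"
  assumes "proper_fun g" and "convex_fun g" and "lsc_fun g"
    and "proper_fun f" and "convex_fun f" and "lsc_fun f"
    and "edom g \<subseteq> edom f"
    and "\<exists>c::real. \<forall>u. ereal c \<le> dc_fun g f u"
    and "\<forall>u. ereal (\<phi> (norm u) + \<beta>) \<le> dc_fun g f u"
    and "\<forall>t\<ge>0. \<phi> t \<ge> 0" and "mono_on {0..} \<phi>" and "continuous_on {0..} \<phi>"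
    and "\<phi> 0 = 0" and "filterlim \<phi> at_top at_top"
    and "m \<ge> 1" and "D1 \<in> spd_class m" and "D2 \<in> spd_class m"
    and "lam > 0" and "mu > 0" and "lam \<ge> m\<^sup>2 * mu"
    and "\<eta> = eta_const m lam mu" and "\<eta>1 = eta1_const m lam mu"
    and "2 * \<eta> / (5 * \<eta> + 2 * \<eta>1) \<le> \<gamma>" and "\<gamma> < 1"
    and "\<forall>n\<ge>1. \<theta> n \<ge> 0"
    and "\<forall>n\<ge>1. w n = x n + \<theta> n *\<^sub>R (x n - x (n - 1))"
    and "\<forall>n\<ge>1. y n = (1 / lam) *\<^sub>R (D1 *v (w n - prox g lam D1 (w n)))"
    and "\<forall>n\<ge>1. z n = (1 / mu) *\<^sub>R (D2 *v (w n - prox f mu D2 (w n)))"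
    and "\<forall>n\<ge>1. x (n + 1) = x n - (\<gamma> / \<eta>) *\<^sub>R (y n - z n)"
  shows "\<forall>n\<ge>1. dc_env g f lam mu D1 D2 (x (n + 1)) \<le>
           dc_env g f lam mu D1 D2 (x n)
           + ereal ((\<eta> * \<theta> n / 2 - \<eta> / \<gamma> + \<eta> / 2) * (norm (x (n + 1) - x n))\<^sup>2
             + (\<eta>1 * (\<theta> n)\<^sup>2 + \<eta> * (\<theta> n)\<^sup>2 + \<eta> * \<theta> n / 2) * (norm (x n - x (n - 1)))\<^sup>2)"
proof (intro allI impI)
  fix n :: nat
  assume n: "n \<ge> 1"
  note g = assms(1-3) \<open>lam > 0\<close> and f = assms(4-6) \<open>mu > 0\<close>
  have D1: "symmetric_pos_def D1" and D2: "symmetric_pos_def D2"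
    using \<open>D1 \<in> spd_class m\<close> \<open>D2 \<in> spd_class m\<close> unfolding spd_class_def by auto
  have D1_le: "v \<bullet> (D1 *v v) \<le> m * (norm v)\<^sup>2" for v
    using \<open>D1 \<in> spd_class m\<close> D1 unfolding spd_class_def symmetric_pos_def_def
    by (intro quadratic_form_le_of_eigenvalues_le) auto
  have D2_le: "v \<bullet> (D2 *v v) \<le> m * (norm v)\<^sup>2" for v
    using \<open>D2 \<in> spd_class m\<close> D2 unfolding spd_class_def symmetric_pos_def_def
    by (intro quadratic_form_le_of_eigenvalues_le) auto
  obtain G where G: "\<And>x. moreau_env g lam D1 x = ereal (G x)"
    and G_upper: "\<And>x u. G u \<le> G x + ((1 / lam) *\<^sub>R (D1 *v (x - prox g lam D1 x))) \<bullet> (u - x)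
                + 1 / (2 * lam) * ((u - x) \<bullet> (D1 *v (u - x)))"
    and G_lower: "\<And>x u. G x + ((1 / lam) *\<^sub>R (D1 *v (x - prox g lam D1 x))) \<bullet> (u - x) \<le> G u"
    using moreau_env_first_order_bounds[OF g D1] by metis
  obtain F where F: "\<And>x. moreau_env f mu D2 x = ereal (F x)"
    and F_upper: "\<And>x u. F u \<le> F x + ((1 / mu) *\<^sub>R (D2 *v (x - prox f mu D2 x))) \<bullet> (u - x)
                + 1 / (2 * mu) * ((u - x) \<bullet> (D2 *v (u - x)))"
    and F_lower: "\<And>x u. F x + ((1 / mu) *\<^sub>R (D2 *v (x - prox f mu D2 x))) \<bullet> (u - x) \<le> F u"
    using moreau_env_first_order_bounds[OF f D2] by metis
  define a where "a = x (n + 1) - x n"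
  define b where "b = x n - x (n - 1)"
  define t where "t = \<theta> n"
  have t: "t \<ge> 0" using assms(25) n t_def by simp
  have w: "w n = x n + t *\<^sub>R b" using assms(26) n by (simp add: t_def b_def)
  have y: "y n = (1 / lam) *\<^sub>R (D1 *v (w n - prox g lam D1 (w n)))" using assms(27) n by simp
  have z: "z n = (1 / mu) *\<^sub>R (D2 *v (w n - prox f mu D2 (w n)))" using assms(28) n by simp
  have m: "m > 0" using \<open>m \<ge> 1\<close> by simp
  \<comment> \<open>\<open>L\<close> and \<open>M\<close> are the curvature constants of the two
    envelopes, obtained from the eigenvalue bound \<open>m\<close>. Since
    \<open>\<eta> = (L + M) * (1 + m\<^sup>2)\<close>, both are at most
    \<open>\<eta>\<close>.\<close>
  define L M where "L = m / lam" and "M = m / mu"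
  have LM: "L > 0" "M > 0" using m \<open>lam > 0\<close> \<open>mu > 0\<close> by (auto simp: L_def M_def)
  have "\<eta> = L + M + (L + M) * m\<^sup>2"
    unfolding \<open>\<eta> = eta_const m lam mu\<close> eta_const_def L_def M_def
    by (simp add: algebra_simps power2_eq_square power3_eq_cube add_divide_distrib)
  then have \<eta>: "L + M \<le> \<eta>" using LM by simp
  have \<eta>1: "\<eta>1 \<ge> 0" unfolding \<open>\<eta>1 = eta1_const m lam mu\<close> eta1_const_def by (simp add: le_max_iff_disj)
  have "0 < 2 * \<eta> / (5 * \<eta> + 2 * \<eta>1)" using \<eta> \<eta>1 LM by (intro divide_pos_pos) auto
  then have \<gamma>: "\<gamma> > 0" using assms(23) by linarith
  have a: "a = - (\<gamma> / \<eta>) *\<^sub>R (y n - z n)" using assms(29) n by (simp add: a_def)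
  \<comment> \<open>The update is solved for the gradient difference, which needs
    \<open>\<gamma>\<close> and \<open>\<eta>\<close> nonzero; its inner product with the step is
    then a negative multiple of \<open>(norm a)\<^sup>2\<close>.\<close>
  have "y n - z n = - (\<eta> / \<gamma>) *\<^sub>R a" unfolding a using \<gamma> \<eta> LM by simp
  then have inner: "(y n - z n) \<bullet> a = - (\<eta> / \<gamma>) * (norm a)\<^sup>2"
    by (simp add: power2_norm_eq_inner)
  have xw: "x (n + 1) - w n = a - t *\<^sub>R b" "x n - w n = - (t *\<^sub>R b)"
    unfolding w a_def by simp_all
  have "1 / (2 * lam) * ((a - t *\<^sub>R b) \<bullet> (D1 *v (a - t *\<^sub>R b)))
      \<le> 1 / (2 * lam) * (m * (norm (a - t *\<^sub>R b))\<^sup>2)"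
    using \<open>lam > 0\<close> by (intro mult_left_mono D1_le) simp
  also have "\<dots> = L / 2 * (norm (a - t *\<^sub>R b))\<^sup>2" by (simp add: L_def)
  also have "\<dots> \<le> L / 2 * ((1 + t) * (norm a)\<^sup>2 + (t\<^sup>2 + t) * (norm b)\<^sup>2)"
    using LM by (intro mult_left_mono norm_diff_scaleR_power2_le t) simp
  finally have "G (x (n + 1)) \<le> G (w n) + y n \<bullet> (a - t *\<^sub>R b)
      + L / 2 * ((1 + t) * (norm a)\<^sup>2 + (t\<^sup>2 + t) * (norm b)\<^sup>2)"
    using G_upper[of "x (n + 1)" "w n"] unfolding y[symmetric] xw by linarith
  moreover have "F (w n) + z n \<bullet> (a - t *\<^sub>R b) \<le> F (x (n + 1))"
    using F_lower[of "w n" "x (n + 1)"] unfolding z[symmetric] xw .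
  moreover have "G (w n) + y n \<bullet> (- (t *\<^sub>R b)) \<le> G (x n)"
    using G_lower[of "w n" "x n"] unfolding y[symmetric] xw .
  moreover have "F (x n) \<le> F (w n) + z n \<bullet> (- (t *\<^sub>R b)) + M / 2 * (t\<^sup>2 * (norm b)\<^sup>2)"
  proof -
    have "1 / (2 * mu) * ((- (t *\<^sub>R b)) \<bullet> (D2 *v (- (t *\<^sub>R b))))
        \<le> 1 / (2 * mu) * (m * (norm (- (t *\<^sub>R b)))\<^sup>2)"
      using \<open>mu > 0\<close> by (intro mult_left_mono D2_le) simp
    also have "\<dots> = M / 2 * (t\<^sup>2 * (norm b)\<^sup>2)" by (simp add: M_def power_mult_distrib)
    finally show ?thesis using F_upper[of "x n" "w n"] unfolding z[symmetric] xw by linarith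
  qed
  \<comment> \<open>On adding the four inequalities, the values at \<open>w n\<close> cancel and so
    do all products with \<open>t *\<^sub>R b\<close>; of the linear terms only
    \<open>(y n - z n) \<bullet> a\<close> survives.\<close>
  ultimately have "G (x (n + 1)) - F (x (n + 1)) \<le> G (x n) - F (x n) + (y n - z n) \<bullet> a
      + L / 2 * ((1 + t) * (norm a)\<^sup>2 + (t\<^sup>2 + t) * (norm b)\<^sup>2) + M / 2 * (t\<^sup>2 * (norm b)\<^sup>2)"
    by (simp add: inner_diff_left inner_diff_right)
  also have "\<dots> = G (x n) - F (x n) - \<eta> / \<gamma> * (norm a)\<^sup>2
      + (L * ((1 + t) / 2)) * (norm a)\<^sup>2 + (L * ((t\<^sup>2 + t) / 2) + M * (t\<^sup>2 / 2)) * (norm b)\<^sup>2"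
    unfolding inner by (simp add: field_simps)
  \<comment> \<open>\<open>L\<close> and \<open>M\<close> are each replaced by
    \<open>\<eta>\<close>. The two halves of \<open>\<eta> * t\<^sup>2\<close> that arise add up to
    the full term, and the nonnegative \<open>\<eta>1 * t\<^sup>2\<close> enlarges the bound to the
    stated coefficient.\<close>
  also have "\<dots> \<le> G (x n) - F (x n) - \<eta> / \<gamma> * (norm a)\<^sup>2
      + (\<eta> * ((1 + t) / 2)) * (norm a)\<^sup>2
      + (\<eta>1 * t\<^sup>2 + \<eta> * ((t\<^sup>2 + t) / 2) + \<eta> * (t\<^sup>2 / 2)) * (norm b)\<^sup>2"
  proof -
    have "L * ((1 + t) / 2) \<le> \<eta> * ((1 + t) / 2)" using \<eta> LM t by (intro mult_right_mono) auto
    then have 1: "(L * ((1 + t) / 2)) * (norm a)\<^sup>2 \<le> (\<eta> * ((1 + t) / 2)) * (norm a)\<^sup>2"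
      by (rule mult_right_mono) simp
    have "L * ((t\<^sup>2 + t) / 2) \<le> \<eta> * ((t\<^sup>2 + t) / 2)" using \<eta> LM t by (intro mult_right_mono) auto
    moreover have "M * (t\<^sup>2 / 2) \<le> \<eta> * (t\<^sup>2 / 2)" using \<eta> LM by (intro mult_right_mono) auto
    moreover have "0 \<le> \<eta>1 * t\<^sup>2" using \<eta>1 by simp
    ultimately have "L * ((t\<^sup>2 + t) / 2) + M * (t\<^sup>2 / 2)
        \<le> \<eta>1 * t\<^sup>2 + \<eta> * ((t\<^sup>2 + t) / 2) + \<eta> * (t\<^sup>2 / 2)" by linarith
    then have "(L * ((t\<^sup>2 + t) / 2) + M * (t\<^sup>2 / 2)) * (norm b)\<^sup>2
        \<le> (\<eta>1 * t\<^sup>2 + \<eta> * ((t\<^sup>2 + t) / 2) + \<eta> * (t\<^sup>2 / 2)) * (norm b)\<^sup>2"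
      by (rule mult_right_mono) simp
    with 1 show ?thesis by linarith
  qed
  also have "\<dots> = G (x n) - F (x n) + ((\<eta> * t / 2 - \<eta> / \<gamma> + \<eta> / 2) * (norm a)\<^sup>2
      + (\<eta>1 * t\<^sup>2 + \<eta> * t\<^sup>2 + \<eta> * t / 2) * (norm b)\<^sup>2)"
    by (simp add: field_simps)
  finally show "dc_env g f lam mu D1 D2 (x (n + 1)) \<le>
           dc_env g f lam mu D1 D2 (x n)
           + ereal ((\<eta> * \<theta> n / 2 - \<eta> / \<gamma> + \<eta> / 2) * (norm (x (n + 1) - x n))\<^sup>2
             + (\<eta>1 * (\<theta> n)\<^sup>2 + \<eta> * (\<theta> n)\<^sup>2 + \<eta> * \<theta> n / 2) * (norm (x n - x (n - 1)))\<^sup>2)"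
    unfolding dc_env_def G F a_def b_def t_def by simp
qed

end
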